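(* Let $G$ be a finite, simple, undirected, connected graph with at least two vertices. If $\gamma_t(G) = i_0(G) + 1$, then $\operatorname{diam}(G) \leq 2$.
   Context: A set $S \subseteq V(G)$ is a total dominating set of $G$ if every vertex of $G$ (including those in $S$) has a neighbor in $S$; $\gamma_t(G)$ is the minimum cardinality of a total dominating set. A set $S \subseteq V(G)$ is an isolate set if the induced subgraph $G[S]$ has at least one isolated vertex (a vertex of degree $0$ in $G[S]$). An isolate set is maximal if no proper superset of it is an isolate set. The isolate number $i_0(G)$ is the minimum cardinality of a maximal isolate set of $G$. $\operatorname{diam}(G)$ denotes the maximum distance between two vertices of $G$. *)

theory Defs
  imports "Graph_Theory.Graph_Theory"
begin

text \<open>
  Finite simple undirected graphs are those of the locale \<^locale>\<open>graph\<close>: finite symmetric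
  digraphs without loops and parallel arcs.  An edge is a pair of opposite arcs, so the degree of
  a vertex is its out-degree.
\<close>

definition total_dominating_set :: "('a, 'b) pre_digraph \<Rightarrow> 'a set \<Rightarrow> bool" where
  "total_dominating_set G S \<longleftrightarrow> S \<subseteq> verts G \<and> (\<forall>v \<in> verts G. \<exists>u \<in> S. v \<rightarrow>\<^bsub>G\<^esub> u)"

text \<open>
  The set of cardinalities is nonempty iff \<open>G\<close> has no isolated vertex; otherwise the value
  is meaningless.
\<close>
definition total_domination_number :: "('a, 'b) pre_digraph \<Rightarrow> nat" where
  "total_domination_number G = (LEAST k. \<exists>S. total_dominating_set G S \<and> card S = k)"

definition isolate_set :: "('a, 'b) pre_digraph \<Rightarrow> 'a set \<Rightarrow> bool" where
  "isolate_set G S \<longleftrightarrow>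
     S \<subseteq> verts G \<and> (\<exists>v \<in> verts (G \<restriction> S). out_degree (G \<restriction> S) v = 0)"

definition maximal_isolate_set :: "('a, 'b) pre_digraph \<Rightarrow> 'a set \<Rightarrow> bool" where
  "maximal_isolate_set G S \<longleftrightarrow> isolate_set G S \<and> \<not> (\<exists>T. isolate_set G T \<and> S \<subset> T)"

definition isolate_number :: "('a, 'b) pre_digraph \<Rightarrow> nat" where
  "isolate_number G = (LEAST k. \<exists>S. maximal_isolate_set G S \<and> card S = k)"

text \<open>The distance is the library's shortest-path cost with unit arc weights.\<close>
definition graph_dist :: "('a, 'b) pre_digraph \<Rightarrow> 'a \<Rightarrow> 'a \<Rightarrow> ereal" where
  "graph_dist G u v = wf_digraph.\<mu> G (\<lambda>_. 1) u v"

text \<open>Only meaningful when the vertex set is finite and nonempty.\<close>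
definition diameter :: "('a, 'b) pre_digraph \<Rightarrow> ereal" where
  "diameter G = Max {graph_dist G u v | u v. u \<in> verts G \<and> v \<in> verts G}"

end

theory Submission
  imports Defs
begin

text \<open>
  A maximal isolate set \<open>S\<close> with isolated vertex \<open>v\<close> is the complement of the neighbourhood of
  \<open>v\<close>, and maximality says that this neighbourhood is inclusion-minimal.  Hence \<open>insert u S\<close> is
  total dominating for each neighbour \<open>u\<close> of \<open>v\<close>.  Let \<open>card S\<close> be the isolate number and suppose
  that \<open>S\<close> contains a vertex other than \<open>v\<close>.  By connectedness, \<open>u\<close> can be chosen adjacent to some
  such vertex \<open>z\<close>.  Because \<open>insert u S\<close> is minimum, each \<open>s\<close> in \<open>S - {v}\<close> has a private neighbour,
  which lies in \<open>S - {v}\<close> and is not adjacent to \<open>u\<close>.  The choice of private neighbours is an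
  injection of \<open>S - {v}\<close> into itself that misses \<open>z\<close>, which is impossible.  So \<open>S = {v}\<close>, and
  \<open>v\<close> is adjacent to all other vertices.
\<close>

lemma out_degree_induce_eq_0_iff:
  assumes "fin_digraph G"
  shows "out_degree (G \<restriction> S) v = 0 \<longleftrightarrow> \<not> (v \<in> S \<and> (\<exists>w \<in> S. v \<rightarrow>\<^bsub>G\<^esub> w))"
proof -
  interpret fin_digraph G by fact
  \<comment> \<open>\<open>out_degree\<close> is a \<open>card\<close>, which is 0 on infinite sets
    too; finiteness makes degree 0 mean that there are no out-arcs.\<close>
  have "finite (out_arcs (G \<restriction> S) v)"
    by (rule finite_subset[OF _ finite_arcs]) (auto simp: out_arcs_def)
  then show ?thesis
    by (auto simp: out_degree_def out_arcs_def arcs_ends_conv)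
qed

lemma isolate_set_iff:
  assumes "fin_digraph G"
  shows "isolate_set G S \<longleftrightarrow> S \<subseteq> verts G \<and> (\<exists>v \<in> S. \<forall>w \<in> S. \<not> v \<rightarrow>\<^bsub>G\<^esub> w)"
  using out_degree_induce_eq_0_iff[OF assms] by (auto simp: isolate_set_def)

lemma total_domination_number_le:
  "total_dominating_set G S \<Longrightarrow> total_domination_number G \<le> card S"
  unfolding total_domination_number_def by (rule Least_le) blast

text \<open>Without loops every singleton is an isolate set, and a finite nonempty family of sets
  has a maximal member, so the \<open>LEAST\<close> is attained.\<close>

lemma isolate_number_attained:
  assumes "digraph G" "verts G \<noteq> {}"
  obtains S where "maximal_isolate_set G S" "card S = isolate_number G"
proof -
  interpret digraph G by fact
  obtain v where "v \<in> verts G" using assms(2) by blast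
  then have "isolate_set G {v}"
    using adj_not_same by (auto simp: isolate_set_iff[OF fin_digraph_axioms])
  moreover have "finite {S. isolate_set G S}"
    by (rule finite_subset[of _ "Pow (verts G)"]) (auto simp: isolate_set_def)
  ultimately obtain S where "isolate_set G S" "\<And>T. isolate_set G T \<Longrightarrow> S \<subseteq> T \<Longrightarrow> S = T"
    using finite_has_maximal[of "{S. isolate_set G S}"] by blast
  then have "maximal_isolate_set G S"
    by (auto simp: maximal_isolate_set_def)
  then have "\<exists>k S. maximal_isolate_set G S \<and> card S = k" by blast
  from LeastI_ex[OF this] show ?thesis
    using that by (auto simp: isolate_number_def)
qed

text \<open>For \<open>v\<close> isolated in \<open>S\<close>, the non-neighbours of
  \<open>v\<close> form an isolate set containing \<open>S\<close>, so maximality forces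
  equality.\<close>

lemma maximal_isolate_set_eq_nonneighbours:
  assumes "digraph G" "maximal_isolate_set G S"
  obtains v where "v \<in> verts G" "S = {w \<in> verts G. \<not> v \<rightarrow>\<^bsub>G\<^esub> w}"
proof -
  interpret digraph G by fact
  note iso = isolate_set_iff[OF fin_digraph_axioms]
  obtain v where v: "v \<in> S" "S \<subseteq> verts G" "\<forall>w \<in> S. \<not> v \<rightarrow>\<^bsub>G\<^esub> w"
    using assms(2) by (auto simp: maximal_isolate_set_def iso)
  have "isolate_set G {w \<in> verts G. \<not> v \<rightarrow>\<^bsub>G\<^esub> w}"
    using v adj_not_same by (auto simp: iso intro!: bexI[of _ v])
  moreover have "S \<subseteq> {w \<in> verts G. \<not> v \<rightarrow>\<^bsub>G\<^esub> w}" using v by auto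
  ultimately have "S = {w \<in> verts G. \<not> v \<rightarrow>\<^bsub>G\<^esub> w}"
    using assms(2) by (auto simp: maximal_isolate_set_def)
  with v that show ?thesis by blast
qed

text \<open>Were the neighbourhood of \<open>w\<close> properly inside that of \<open>v\<close>, the
  non-neighbours of \<open>w\<close> would be a strictly larger isolate set.\<close>

lemma maximal_isolate_set_neighbourhood_minimal:
  assumes "digraph G" "v \<in> verts G" "maximal_isolate_set G {w \<in> verts G. \<not> v \<rightarrow>\<^bsub>G\<^esub> w}"
    and "w \<in> verts G" "\<And>x. w \<rightarrow>\<^bsub>G\<^esub> x \<Longrightarrow> v \<rightarrow>\<^bsub>G\<^esub> x" "v \<rightarrow>\<^bsub>G\<^esub> u"
  shows "w \<rightarrow>\<^bsub>G\<^esub> u"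
proof (rule ccontr)
  interpret digraph G by fact
  assume "\<not> w \<rightarrow>\<^bsub>G\<^esub> u"
  moreover have "isolate_set G {x \<in> verts G. \<not> w \<rightarrow>\<^bsub>G\<^esub> x}"
    using assms(4) adj_not_same
    by (auto simp: isolate_set_iff[OF fin_digraph_axioms] intro!: bexI[of _ w])
  moreover have "u \<in> verts G" using assms(6) by (rule adj_in_verts)
  ultimately show False
    using assms(3,5,6) by (auto simp: maximal_isolate_set_def)
qed

lemma (in wf_digraph) reachable_leaves_set:
  assumes "v \<rightarrow>\<^sup>* y" "v \<in> A" "y \<notin> A"
  obtains a b where "a \<in> A" "b \<notin> A" "a \<rightarrow>\<^bsub>G\<^esub> b"
proof -
  have "y \<in> A \<or> (\<exists>a b. a \<in> A \<and> b \<notin> A \<and> a \<rightarrow>\<^bsub>G\<^esub> b)"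
    using assms(1,2) by (induction rule: reachable_induct) auto
  with assms(3) that show ?thesis by blast
qed

lemma (in wf_digraph) graph_dist_le_awalk_length:
  assumes "awalk u p v"
  shows "graph_dist G u v \<le> length p"
proof -
  have "awalk_cost (\<lambda>_. 1) p = length p" by (induction p) auto
  with min_cost_le_walk_cost[OF assms, of "\<lambda>_. 1"] show ?thesis
    by (simp add: graph_dist_def)
qed

lemma diameter_le_2_if_universal_vertex:
  assumes "graph G" "v \<in> verts G" "\<And>w. w \<in> verts G \<Longrightarrow> w \<noteq> v \<Longrightarrow> v \<rightarrow>\<^bsub>G\<^esub> w"
  shows "diameter G \<le> 2"
proof -
  interpret graph G by fact
  have dist: "graph_dist G x y \<le> 2" if xy: "x \<in> verts G" "y \<in> verts G" for x y
  proof -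
    have to: "\<exists>p. awalk x p v \<and> length p \<le> 1"
    proof (cases "x = v")
      case True
      then show ?thesis using assms(2) by (auto intro!: exI[of _ "[]"] simp: awalk_simps)
    next
      case False
      then have "x \<rightarrow>\<^bsub>G\<^esub> v" using assms(3) xy arcs_ends_symmetric[OF sym_arcs] by blast
      then obtain e where "e \<in> arcs G" "tail G e = x" "head G e = v" by auto
      then show ?thesis by (auto intro!: exI[of _ "[e]"] simp: awalk_simps)
    qed
    have "\<exists>p. awalk v p y \<and> length p \<le> 1"
    proof (cases "y = v")
      case True
      then show ?thesis using assms(2) by (auto intro!: exI[of _ "[]"] simp: awalk_simps)
    next
      case False
      then have "v \<rightarrow>\<^bsub>G\<^esub> y" using assms(3) xy by blast
      then obtain e where "e \<in> arcs G" "tail G e = v" "head G e = y" by auto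
      then show ?thesis by (auto intro!: exI[of _ "[e]"] simp: awalk_simps)
    qed
    with to obtain p q where pq: "awalk x p v" "awalk v q y" "length p \<le> 1" "length q \<le> 1"
      by blast
    have "graph_dist G x y \<le> length (p @ q)"
      using pq by (intro graph_dist_le_awalk_length awalk_appendI)
    also have "ereal (length (p @ q)) \<le> ereal 2"
      unfolding ereal_less_eq using pq(3,4) by simp
    finally show ?thesis by simp
  qed
  have eq: "{graph_dist G x y | x y. x \<in> verts G \<and> y \<in> verts G}
    = (\<lambda>(x, y). graph_dist G x y) ` (verts G \<times> verts G)" by auto
  show ?thesis
    unfolding diameter_def eq using assms(2) dist by (subst Max_le_iff) auto
qed

theorem theorem2p3:
  fixes G :: "('a, 'b) pre_digraph"
  assumes "graph G"
    and "Digraph_Component.connected G"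
    and "card (verts G) \<ge> 2"
    and "total_domination_number G = isolate_number G + 1"
  shows "diameter G \<le> 2"
proof -
  interpret graph G by fact
  note adj_sym = arcs_ends_symmetric[OF sym_arcs]
  have conn: "strongly_connected G"
    using symmetric_connected_imp_strongly_connected[OF sym_arcs assms(2)] .
  have "verts G \<noteq> {}" using assms(3) by auto
  then obtain S where S: "maximal_isolate_set G S" "card S = isolate_number G"
    using isolate_number_attained[OF digraph_axioms] by blast
  then obtain v where v: "v \<in> verts G" and S_eq: "S = {w \<in> verts G. \<not> v \<rightarrow>\<^bsub>G\<^esub> w}"
    using maximal_isolate_set_eq_nonneighbours[OF digraph_axioms] by blast
  have "finite S" "v \<in> S" using v adj_not_same by (auto simp: S_eq)
  define R where "R = S - {v}"
  have "R = {}"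
  proof (rule ccontr)
    assume "R \<noteq> {}"
    then obtain y where y: "y \<in> R" by blast
    then have "v \<rightarrow>\<^sup>*\<^bsub>G\<^esub> y" using conn v by (auto simp: R_def S_eq strongly_connected_def)
    moreover have "v \<in> - R" "y \<notin> - R" using y by (auto simp: R_def)
    ultimately obtain u z where "u \<in> - R" "z \<notin> - R" "u \<rightarrow>\<^bsub>G\<^esub> z"
      by (rule reachable_leaves_set)
    \<comment> \<open>\<open>u\<close> is not \<open>v\<close>, since \<open>z\<close> in
      \<open>S\<close> is no neighbour of \<open>v\<close>; so \<open>u\<close> lies outside
      \<open>S\<close>, hence is adjacent to \<open>v\<close>.\<close>
    then have z: "z \<in> R" and uz: "u \<rightarrow>\<^bsub>G\<^esub> z" and vu: "v \<rightarrow>\<^bsub>G\<^esub> u"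
      by (auto simp: R_def S_eq dest: adj_in_verts)
    have "u \<notin> S" using vu by (simp add: S_eq)
    have "\<exists>w \<in> R. \<not> w \<rightarrow>\<^bsub>G\<^esub> u \<and> {x \<in> S. w \<rightarrow>\<^bsub>G\<^esub> x} = {s}" if "s \<in> R" for s
    proof -
      have s: "s \<in> S" "s \<noteq> v" using that by (auto simp: R_def)
      \<comment> \<open>Exchanging \<open>s\<close> for \<open>u\<close> keeps the size one below
        the total domination number, so some \<open>w\<close> has no neighbour in
        \<open>?T\<close>.\<close>
      let ?T = "insert u (S - {s})"
      have "card ?T = card S"
        using \<open>finite S\<close> \<open>u \<notin> S\<close> s card_Suc_Diff1[of S s] by simp
      then have "\<not> total_dominating_set G ?T"
        using total_domination_number_le[of G ?T] assms(4) S(2) by auto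
      moreover have "?T \<subseteq> verts G" using vu by (auto simp: S_eq dest: adj_in_verts)
      ultimately obtain w where w: "w \<in> verts G" "\<And>x. x \<in> ?T \<Longrightarrow> \<not> w \<rightarrow>\<^bsub>G\<^esub> x"
        by (auto simp: total_dominating_set_def)
      have "w \<noteq> v" using w vu by auto
      \<comment> \<open>As \<open>s\<close> is not \<open>v\<close>, the vertex \<open>v\<close>
        remains in \<open>?T\<close>.\<close>
      moreover have "\<not> v \<rightarrow>\<^bsub>G\<^esub> w" using w(2)[of v] \<open>v \<in> S\<close> s adj_sym by blast
      ultimately have "w \<in> R" using w by (simp add: R_def S_eq)
      \<comment> \<open>Otherwise \<open>w\<close> has no neighbour in \<open>S\<close>, so its
        neighbourhood lies in that of \<open>v\<close>, and minimality makes it adjacent to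
        \<open>u\<close>.\<close>
      have "w \<rightarrow>\<^bsub>G\<^esub> s"
      proof (rule ccontr)
        assume "\<not> w \<rightarrow>\<^bsub>G\<^esub> s"
        then have "v \<rightarrow>\<^bsub>G\<^esub> x" if "w \<rightarrow>\<^bsub>G\<^esub> x" for x
          using w(2)[of x] that by (auto simp: S_eq dest: adj_in_verts)
        with w(1) vu have "w \<rightarrow>\<^bsub>G\<^esub> u"
          using maximal_isolate_set_neighbourhood_minimal[OF digraph_axioms v S(1)[unfolded S_eq]]
          by blast
        with w(2) show False by simp
      qed
      with w s have "{x \<in> S. w \<rightarrow>\<^bsub>G\<^esub> x} = {s}" by auto
      with \<open>w \<in> R\<close> w show ?thesis by blast
    qed
    then have "\<forall>s \<in> R. \<exists>w. w \<in> R \<and> \<not> w \<rightarrow>\<^bsub>G\<^esub> u \<and> {x \<in> S. w \<rightarrow>\<^bsub>G\<^esub> x} = {s}" by blast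
    from bchoice[OF this] obtain f
      where f: "\<And>s. s \<in> R \<Longrightarrow> f s \<in> R" "\<And>s. s \<in> R \<Longrightarrow> \<not> f s \<rightarrow>\<^bsub>G\<^esub> u"
        "\<And>s. s \<in> R \<Longrightarrow> {x \<in> S. f s \<rightarrow>\<^bsub>G\<^esub> x} = {s}"
      by blast
    \<comment> \<open>\<open>f s\<close> determines \<open>s\<close> as its only neighbour in
      \<open>S\<close>.\<close>
    have "inj_on f R"
    proof (rule inj_onI)
      fix s t assume st: "s \<in> R" "t \<in> R" "f s = f t"
      have "{s} = {t}" using f(3)[OF st(1)] unfolding st(3) f(3)[OF st(2)] by (rule sym)
      then show "s = t" by (rule singleton_inject)
    qed
    moreover have "f ` R \<subseteq> R" using f(1) by blast
    moreover have "finite R" using \<open>finite S\<close> by (simp add: R_def)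
    ultimately have "f ` R = R" by (simp add: endo_inj_surj)
    then obtain s where "s \<in> R" "z = f s" using z by blast
    \<comment> \<open>\<open>z\<close> is adjacent to \<open>u\<close>, but no value of
      \<open>f\<close> on \<open>R\<close> is.\<close>
    with f(2) adj_sym[OF uz] show False by simp
  qed
  then show ?thesis
    using v by (intro diameter_le_2_if_universal_vertex[OF assms(1) v]) (auto simp: R_def S_eq)
qed

end
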